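(* Let $C\subset\mathbb{R}^n$ be compact, let $N\in\mathbb{N}_0$, and let $K\subset C$ be a convex body. Suppose that $K=C\cap\{x\in\mathbb{R}^n: p(x)\ge 0\}$ for some real polynomial $p\neq 0$ in $n$ variables of degree at most $N$. Then $K$ is uniquely determined in the class of all convex bodies contained in $C$ by its geometric moments $\mu_\alpha(K)$, $\alpha\in\mathbb{N}_0^n$ with $|\alpha|\le N$; that is, if $L\subset C$ is a convex body with $\mu_\alpha(L)=\mu_\alpha(K)$ for all $\alpha\in\mathbb{N}_0^n$ with $|\alpha|\le N$, then $L=K$.
   Context: A convex body is a compact, convex subset of $\mathbb{R}^n$ with nonempty interior. For a compact set $K\subset\mathbb{R}^n$ and a multi-index $\alpha\in\mathbb{N}_0^n$, the geometric moment of order $|\alpha|=\alpha_1+\dots+\alpha_n$ is $\mu_\alpha(K)=\int_K x^\alpha\,dx$, where $x^\alpha=x_1^{\alpha_1}\cdots x_n^{\alpha_n}$. *)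

theory Defs
  imports "HOL-Analysis.Analysis" "HOL-Library.Poly_Mapping"
begin

definition convex_body :: "(real ^ 'n) set \<Rightarrow> bool" where
  "convex_body K \<longleftrightarrow> compact K \<and> convex K \<and> interior K \<noteq> {}"

type_synonym 'n multi_index = "nat ^ 'n"

definition mi_order :: "'n::finite multi_index \<Rightarrow> nat" where
  "mi_order \<alpha> = (\<Sum>i\<in>UNIV. \<alpha> $ i)"

definition mi_power :: "real ^ 'n \<Rightarrow> 'n::finite multi_index \<Rightarrow> real" where
  "mi_power x \<alpha> = (\<Prod>i\<in>UNIV. (x $ i) ^ (\<alpha> $ i))"

definition geom_moment :: "'n::finite multi_index \<Rightarrow> (real ^ 'n) set \<Rightarrow> real" where
  "geom_moment \<alpha> K = (LINT x:K|lborel. mi_power x \<alpha>)"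

text \<open>Real polynomials in the variables indexed by \<open>'n\<close>, as finitely supported families of
  coefficients: \<open>Poly_Mapping.lookup p \<alpha>\<close> is the coefficient of the monomial with exponent
  vector \<open>\<alpha>\<close>.\<close>

type_synonym 'n real_mpoly = "'n multi_index \<Rightarrow>\<^sub>0 real"

definition mpoly_eval :: "'n::finite real_mpoly \<Rightarrow> real ^ 'n \<Rightarrow> real" where
  "mpoly_eval p x = (\<Sum>\<alpha>\<in>Poly_Mapping.keys p. Poly_Mapping.lookup p \<alpha> * mi_power x \<alpha>)"

text \<open>Total degree. The inserted \<open>0\<close> matters only for \<open>p = 0\<close>, to which it assigns degree \<open>0\<close>.\<close>

definition mpoly_degree :: "'n::finite real_mpoly \<Rightarrow> nat" where
  "mpoly_degree p = Max (insert 0 (mi_order ` Poly_Mapping.keys p))"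

end

theory Submission
  imports Defs
begin

text \<open>Since \<open>p\<close> is a combination of monomials of order at most \<open>N\<close>, its integrals over \<open>K\<close> and \<open>L\<close>
  agree, hence so do its integrals over \<open>L - K\<close> and \<open>K - L\<close>. But \<open>p < 0\<close> on \<open>L - K\<close> and \<open>p \<ge> 0\<close> on
  \<open>K - L\<close>, so \<open>L - K\<close> is a null set, and so is \<open>K - L\<close> because \<open>K\<close> and \<open>L\<close> have the same volume (the
  moment of order \<open>0\<close>). Convex bodies that differ by null sets are equal.\<close>

lemma continuous_on_mi_power: "continuous_on S (\<lambda>x. mi_power x \<alpha>)"
  unfolding mi_power_def by (intro continuous_intros)

lemma continuous_on_mpoly_eval: "continuous_on S (mpoly_eval p)"
  unfolding mpoly_eval_def by (intro continuous_intros continuous_on_mi_power)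

lemma mi_order_le_mpoly_degree:
  assumes "\<alpha> \<in> Poly_Mapping.keys p"
  shows "mi_order \<alpha> \<le> mpoly_degree p"
  unfolding mpoly_degree_def using assms by (intro Max_ge) auto

text \<open>Compactness makes every monomial integrable, so the integral passes through the finite
  sum. This turns equality of moments into equality of integrals of a polynomial.\<close>

lemma set_lborel_integral_mpoly_eval:
  assumes "compact K"
  shows "(LINT x:K|lborel. mpoly_eval p x) =
    (\<Sum>\<alpha>\<in>Poly_Mapping.keys p. Poly_Mapping.lookup p \<alpha> * geom_moment \<alpha> K)"
proof -
  have "set_integrable lborel K (\<lambda>x. mi_power x \<alpha>)" for \<alpha>
    unfolding set_integrable_def
    using borel_integrable_compact[OF assms continuous_on_mi_power] by (simp add: scaleR_conv_of_real)
  then show ?thesis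
    unfolding mpoly_eval_def geom_moment_def set_lebesgue_integral_def set_integrable_def
    by (simp add: sum_distrib_left mult.left_commute[of "indicator _ _"] del: sum_mult_indicator sum_indicator_mult)
qed

lemma geom_moment_0: "geom_moment 0 K = measure lborel K"
  by (simp add: geom_moment_def mi_power_def set_lebesgue_integral_def)

text \<open>The set \<open>interior L - K\<close> is open and negligible, hence empty. The closed
  set \<open>K\<close> then contains the closure of \<open>interior L\<close>, which is all of
  \<open>L\<close> because a convex closed set with nonempty interior is the closure of that
  interior.\<close>

lemma convex_body_subset_of_null_diff:
  assumes L: "convex_body L" and K: "compact K" and null: "L - K \<in> null_sets lborel"
  shows "L \<subseteq> K"
proof -
  have "negligible (L - K)"
    using null by (simp add: negligible_iff_null_sets null_sets_completionI)
  then have "negligible (interior L - K)"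
    by (rule negligible_subset) (use interior_subset in auto)
  moreover have "open (interior L - K)"
    using K by (simp add: open_Diff compact_imp_closed)
  ultimately have "interior L \<subseteq> K"
    using open_not_negligible by blast
  then have "closure (interior L) \<subseteq> K"
    using K by (simp add: closure_minimal compact_imp_closed)
  moreover have "closure (interior L) = L"
    using L by (simp add: convex_body_def convex_closure_interior compact_imp_closed)
  ultimately show ?thesis
    by simp
qed

text \<open>The function \<open>-f\<close>, cut off outside \<open>A\<close>, is nonnegative with
  integral at most 0, so it vanishes almost everywhere. On \<open>A\<close> it is strictly
  positive.\<close>

lemma null_set_if_neg_on:
  fixes f :: "'a \<Rightarrow> real"
  assumes A: "A \<in> sets M" and int: "set_integrable M A f"
    and neg: "\<And>x. x \<in> A \<Longrightarrow> f x < 0" and nonneg: "0 \<le> (LINT x:A|M. f x)"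
  shows "A \<in> null_sets M"
proof -
  let ?g = "\<lambda>x. - (indicator A x *\<^sub>R f x)"
  have g: "integrable M ?g"
    using int unfolding set_integrable_def by simp
  have pos: "AE x in M. 0 \<le> ?g x"
    using neg by (auto simp: indicator_def less_imp_le)
  have "integral\<^sup>L M ?g = 0"
    using nonneg integral_nonneg_AE[OF pos] by (simp add: set_lebesgue_integral_def)
  then have "AE x in M. ?g x = 0"
    using integral_nonneg_eq_0_iff_AE[OF g pos] by simp
  then have "AE x in M. x \<notin> A"
    by eventually_elim (use neg in \<open>force simp: indicator_def\<close>)
  then show ?thesis
    using A by (simp add: AE_iff_null_sets)
qed

theorem corollary3p2:
  fixes C K :: "(real ^ 'n::finite) set"
    and N :: nat
    and p :: "'n real_mpoly"
  assumes "compact C"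
    and "convex_body K"
    and "K \<subseteq> C"
    and "p \<noteq> 0"
    and "mpoly_degree p \<le> N"
    and "K = C \<inter> {x. mpoly_eval p x \<ge> 0}"
  shows "\<forall>L. convex_body L \<and> L \<subseteq> C \<and>
      (\<forall>\<alpha>. mi_order \<alpha> \<le> N \<longrightarrow> geom_moment \<alpha> L = geom_moment \<alpha> K) \<longrightarrow> L = K"
proof (intro allI impI)
  fix L
  assume "convex_body L \<and> L \<subseteq> C \<and>
      (\<forall>\<alpha>. mi_order \<alpha> \<le> N \<longrightarrow> geom_moment \<alpha> L = geom_moment \<alpha> K)"
  then have L: "convex_body L" and LC: "L \<subseteq> C"
    and mom: "\<And>\<alpha>. mi_order \<alpha> \<le> N \<Longrightarrow> geom_moment \<alpha> L = geom_moment \<alpha> K"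
    by auto
  let ?f = "mpoly_eval p"
  have cK: "compact K" and cL: "compact L"
    using assms(2) L by (auto simp: convex_body_def)
  have sets [measurable]: "K \<in> sets lborel" "L \<in> sets lborel"
    using cK cL by (auto intro: borel_compact)
  have intK: "set_integrable lborel K ?f" and intL: "set_integrable lborel L ?f"
    unfolding set_integrable_def
    using borel_integrable_compact[OF cK continuous_on_mpoly_eval]
      borel_integrable_compact[OF cL continuous_on_mpoly_eval]
    by (simp_all add: scaleR_conv_of_real)
  have int_sub: "set_integrable lborel A ?f" if "A \<in> sets lborel" "A \<subseteq> K \<or> A \<subseteq> L" for A
    using that intK intL set_integrable_subset by blast
  have split: "(LINT x:A|lborel. ?f x) = (LINT x:(A \<inter> B)|lborel. ?f x) + (LINT x:(A - B)|lborel. ?f x)"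
    if "set_integrable lborel A ?f" "A \<in> sets lborel" "B \<in> sets lborel" for A B
  proof -
    have "set_integrable lborel (A \<inter> B) ?f" "set_integrable lborel (A - B) ?f"
      using that by (auto intro: set_integrable_subset)
    then have "(LINT x:((A \<inter> B) \<union> (A - B))|lborel. ?f x) =
        (LINT x:(A \<inter> B)|lborel. ?f x) + (LINT x:(A - B)|lborel. ?f x)"
      by (intro set_integral_Un) auto
    then show ?thesis
      by (simp add: Int_Diff_Un)
  qed
  have "(LINT x:L|lborel. ?f x) = (LINT x:K|lborel. ?f x)"
    unfolding set_lborel_integral_mpoly_eval[OF cK] set_lborel_integral_mpoly_eval[OF cL]
    using mom mi_order_le_mpoly_degree assms(5) by (intro sum.cong) (auto intro: order_trans)
  \<comment> \<open>The integral over \<open>K \<inter> L\<close> is a common summand of both sides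
    and cancels.\<close>
  then have "(LINT x:(L - K)|lborel. ?f x) = (LINT x:(K - L)|lborel. ?f x)"
    using split[OF intK sets] split[OF intL sets(2) sets(1)] by (simp add: Int_commute)
  moreover have "0 \<le> (LINT x:(K - L)|lborel. ?f x)"
    unfolding set_lebesgue_integral_def using assms(6)
    by (intro integral_nonneg_AE) (auto simp: indicator_def)
  \<comment> \<open>A point of \<open>L - K\<close> lies in \<open>C\<close>, so it can be outside
    \<open>K\<close> only by violating \<open>mpoly_eval p x \<ge> 0\<close>.\<close>
  ultimately have "L - K \<in> null_sets lborel"
    using LC assms(6) sets by (intro null_set_if_neg_on[where f = ?f] int_sub) auto
  then have LK: "L \<subseteq> K"
    by (rule convex_body_subset_of_null_diff[OF L cK])
  have "measure lborel L = measure lborel K"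
    using mom[of 0] by (simp add: geom_moment_0 mi_order_def)
  moreover have "measure lborel (K - L) = measure lborel K - measure lborel L"
    using LK sets emeasure_compact_finite[OF cK] by (intro measure_Diff) auto
  \<comment> \<open>\<open>measure\<close> is also 0 on sets of infinite \<open>emeasure\<close>;
    boundedness of \<open>K - L\<close> excludes this.\<close>
  ultimately have "emeasure lborel (K - L) = 0"
    using emeasure_bounded_finite[of "K - L"] cK
    by (simp add: emeasure_eq_ennreal_measure bounded_diff compact_imp_bounded less_top)
  then have "K - L \<in> null_sets lborel"
    using sets by (intro null_setsI) auto
  then have "K \<subseteq> L"
    by (rule convex_body_subset_of_null_diff[OF assms(2) cL])
  with LK show "L = K"
    by blast
qed

end
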